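(* Let $G$ be a connected graph with $|L(G)|\geq 4$, and let $i\in\{0,1,2\}$. Assume that it is not the case that simultaneously $i=2$, $|L_o(G)|=3$ and $|L_e(G)|=2$. If $w(G)\leq \ell(G)-i$, then $\chi(G)\leq \ell(G)-i$.
   Context: All graphs are finite, simple and undirected. $L(G)$ denotes the set of all integers $m$ such that $G$ contains a cycle of length $m$; $L_o(G)$ and $L_e(G)$ denote the sets of odd, respectively even, elements of $L(G)$. $\ell(G)$ denotes the length of a longest cycle of $G$. $w(G)$ denotes the clique number of $G$ (the number of vertices of a largest clique) and $\chi(G)$ the chromatic number. *)

theory Defs
  imports "Graph_Theory.Digraph_Component"
begin

text \<open>
  A finite simple undirected graph is a \<open>pair_graph\<close>: a finite, loop-free, symmetric
  digraph whose arcs are ordered pairs, every edge being represented by its two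
  orientations.
\<close>

text \<open>
  Going back and forth along an edge is a \<open>cycle\<close> of length 2 in the digraph sense;
  the bound below removes exactly these, as a longer \<open>cycle\<close> visits at least three
  distinct vertices.
\<close>

definition cycle_lengths :: "'a pair_pre_digraph \<Rightarrow> nat set" where
  "cycle_lengths G = {length p |p. pre_digraph.cycle (with_proj G) p \<and> 3 \<le> length p}"

definition odd_cycle_lengths :: "'a pair_pre_digraph \<Rightarrow> nat set" where
  "odd_cycle_lengths G = {m \<in> cycle_lengths G. odd m}"

definition even_cycle_lengths :: "'a pair_pre_digraph \<Rightarrow> nat set" where
  "even_cycle_lengths G = {m \<in> cycle_lengths G. even m}"

text \<open>Unspecified for a graph without cycles.\<close>

definition circumference :: "'a pair_pre_digraph \<Rightarrow> nat" where
  "circumference G = Max (cycle_lengths G)"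

definition is_clique :: "'a pair_pre_digraph \<Rightarrow> 'a set \<Rightarrow> bool" where
  "is_clique G K \<longleftrightarrow> K \<subseteq> pverts G \<and> (\<forall>u\<in>K. \<forall>v\<in>K. u \<noteq> v \<longrightarrow> (u, v) \<in> parcs G)"

definition clique_number :: "'a pair_pre_digraph \<Rightarrow> nat" where
  "clique_number G = Max {card K |K. is_clique G K}"

definition proper_colouring :: "'a pair_pre_digraph \<Rightarrow> nat \<Rightarrow> ('a \<Rightarrow> nat) \<Rightarrow> bool" where
  "proper_colouring G k c \<longleftrightarrow>
     (\<forall>v\<in>pverts G. c v < k) \<and> (\<forall>(u, v)\<in>parcs G. c u \<noteq> c v)"

definition chromatic_number :: "'a pair_pre_digraph \<Rightarrow> nat" where
  "chromatic_number G = (LEAST k. \<exists>c. proper_colouring G k c)"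

end

theory Submission
  imports Defs
begin

text \<open>
  Put \<open>k = \<ell> - i\<close>, where \<open>\<ell> \<ge> 6\<close> is the circumference, and let \<open>S\<close> be a minimal set of
  vertices that is not \<open>k\<close>-colourable, so that degrees in \<open>S\<close> are at least \<open>k\<close>. All neighbours
  of the start of a longest path in \<open>S\<close> are among its first \<open>\<ell>\<close> vertices, since no cycle is
  longer than \<open>\<ell>\<close>. If they are always among the first \<open>k + 1\<close> vertices, then reversing initial
  segments of the path shows that these vertices form a clique, which is excluded. Otherwise
  \<open>i = 2\<close>, and the first \<open>\<ell> = k + 2\<close> vertices of some longest path form a set \<open>C\<close> spanned by a
  cycle. Each vertex of \<open>C\<close> except the last one on the path is the start of a longest path whose
  first \<open>\<ell>\<close> vertices are \<open>C\<close>, hence has all its neighbours in \<open>C\<close>. By minimality \<open>C = S\<close>, as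
  otherwise colourings of the two sides could be glued at that last vertex. Now the complement
  of the graph on \<open>S\<close> is a matching: two edges of it give a \<open>k\<close>-colouring, and at most one
  gives a clique of size \<open>k + 1\<close>.
\<close>

section \<open>Colourings of vertex sets: extension and gluing\<close>

text \<open>The notions below take a vertex set and refer to the subgraph induced on it, so that a
  minimal counterexample can simply be a set.\<close>

locale simple_graph =
  fixes adj :: "'a \<Rightarrow> 'a \<Rightarrow> bool"
  assumes adj_sym: "adj u v \<Longrightarrow> adj v u"
    and adj_irrefl: "\<not> adj u u"
begin

definition nbrs :: "'a set \<Rightarrow> 'a \<Rightarrow> 'a set" where
  "nbrs S v = {u \<in> S. adj v u}"

definition clique :: "'a set \<Rightarrow> bool" where
  "clique K \<longleftrightarrow> (\<forall>u\<in>K. \<forall>v\<in>K. u \<noteq> v \<longrightarrow> adj u v)"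

definition colourable :: "'a set \<Rightarrow> nat \<Rightarrow> bool" where
  "colourable S k \<longleftrightarrow> (\<exists>c. (\<forall>v\<in>S. c v < k) \<and> (\<forall>u\<in>S. \<forall>v\<in>S. adj u v \<longrightarrow> c u \<noteq> c v))"

definition path :: "'a set \<Rightarrow> 'a list \<Rightarrow> bool" where
  "path S xs \<longleftrightarrow> distinct xs \<and> set xs \<subseteq> S \<and> successively adj xs"

definition longest :: "'a set \<Rightarrow> 'a list \<Rightarrow> bool" where
  "longest S xs \<longleftrightarrow> path S xs \<and> xs \<noteq> [] \<and> (\<forall>ys. path S ys \<longrightarrow> length ys \<le> length xs)"

lemma nbrs_subset: "nbrs S v \<subseteq> S - {v}"
  using adj_irrefl by (auto simp: nbrs_def)

text \<open>At most \<open>card (nbrs S v)\<close> colours occur around \<open>v\<close>, so one of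
  the \<open>k\<close> is free. Contrapositively, degrees in a minimal set that is not
  \<open>k\<close>-colourable are at least \<open>k\<close>.\<close>

lemma colourable_extend:
  assumes "colourable (S - {v}) k" "finite S" "card (nbrs S v) < k"
  shows "colourable S k"
proof -
  obtain c where c: "\<forall>u\<in>S - {v}. c u < k"
      "\<forall>u\<in>S - {v}. \<forall>w\<in>S - {v}. adj u w \<longrightarrow> c u \<noteq> c w"
    using assms(1) by (auto simp: colourable_def)
  have fin: "finite (nbrs S v)"
    using assms(2) by (auto simp: nbrs_def)
  have "card (c ` nbrs S v) < card {..<k}"
    using card_image_le[OF fin, of c] assms(3) by simp
  then have "\<not> {..<k} \<subseteq> c ` nbrs S v"
    using fin card_mono[of "c ` nbrs S v" "{..<k}"] by auto
  then obtain a where a: "a < k" "a \<notin> c ` nbrs S v"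
    by auto
  show ?thesis
    unfolding colourable_def
  proof (intro exI[of _ "c(v := a)"] conjI ballI impI)
    fix u assume "u \<in> S" then show "(c(v := a)) u < k"
      using a c by auto
  next
    fix u w assume uw: "u \<in> S" "w \<in> S" "adj u w"
    then have "u \<noteq> w" using adj_irrefl by auto
    then show "(c(v := a)) u \<noteq> (c(v := a)) w"
      using a c(2) uw adj_sym[OF uw(3)] by (auto simp: nbrs_def image_iff)
  qed
qed

text \<open>By \<open>closed\<close> and symmetry, every edge in \<open>S\<close> lies inside
  \<open>C\<close> or inside \<open>S - (C - {b})\<close>.\<close>

lemma colourable_glue:
  assumes "colourable C k" and "colourable (S - (C - {b})) k"
    and C: "C \<subseteq> S" "b \<in> C"
    and closed: "\<And>u. u \<in> C \<Longrightarrow> u \<noteq> b \<Longrightarrow> nbrs S u \<subseteq> C"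
  shows "colourable S k"
proof -
  obtain f where f: "\<forall>v\<in>C. f v < k" "\<forall>u\<in>C. \<forall>v\<in>C. adj u v \<longrightarrow> f u \<noteq> f v"
    using assms(1) by (auto simp: colourable_def)
  obtain g where g: "\<forall>v\<in>S - (C - {b}). g v < k"
     "\<forall>u\<in>S - (C - {b}). \<forall>v\<in>S - (C - {b}). adj u v \<longrightarrow> g u \<noteq> g v"
    using assms(2) by (auto simp: colourable_def)
  \<comment> \<open>The two colourings overlap only in \<open>b\<close>; a permutation of the colours makes them agree there.\<close>
  define t where "t = transpose (f b) (g b)"
  have t: "t (f b) = g b" "\<And>x y. t x = t y \<longleftrightarrow> x = y" "\<And>x. x < k \<Longrightarrow> t x < k"
    using f(1) g(1) C by (auto simp: t_def Transposition.transpose_def)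
  define h where "h v = (if v \<in> C then t (f v) else g v)" for v
  have hb: "h v = g v" if "v \<in> S - (C - {b})" for v
    using that t(1) by (auto simp: h_def)
  show ?thesis
    unfolding colourable_def
  proof (intro exI[of _ h] conjI ballI impI)
    fix u assume "u \<in> S" then show "h u < k"
      using f g t by (auto simp: h_def)
  next
    fix u v assume uv: "u \<in> S" "v \<in> S" "adj u v"
    consider "u \<in> C" "v \<in> C" | "u \<in> S - (C - {b})" "v \<in> S - (C - {b})"
      using closed[of u] closed[of v] uv adj_sym[OF uv(3)] by (auto simp: nbrs_def)
    then show "h u \<noteq> h v"
    proof cases
      case 1
      then show ?thesis using f(2) t(2) uv(3) by (auto simp: h_def)
    next
      case 2
      then show ?thesis using g(2) uv(3) hb by auto
    qed
  qed
qed

section \<open>Longest paths and changes of their start\<close>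

lemma longest_exists:
  assumes "finite S" "S \<noteq> {}"
  obtains xs where "longest S xs"
proof -
  obtain v where v: "v \<in> S" using assms(2) by auto
  have b: "\<forall>ys. path S ys \<and> ys \<noteq> [] \<longrightarrow> length ys < Suc (card S)"
    by (metis assms(1) card_mono distinct_card less_Suc_eq_le path_def)
  have "path S [v] \<and> [v] \<noteq> []"
    using v by (auto simp: path_def)
  from ex_has_greatest_nat[where P = "\<lambda>ys. path S ys \<and> ys \<noteq> []" and f = length, OF this, of "Suc (card S)"] b
  obtain xs where "path S xs" "xs \<noteq> []" "\<forall>ys. path S ys \<and> ys \<noteq> [] \<longrightarrow> length ys \<le> length xs"
    by (meson less_imp_le)
  then have "longest S xs"
    by (metis longest_def le0 list.size(3))
  then show ?thesis by (rule that)
qed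

lemma longest_cong:
  assumes "longest S xs" "path S ys" "length ys = length xs"
  shows "longest S ys"
  using assms by (auto simp: longest_def)

text \<open>Fixing the last vertex of the segment preserves the edge into \<open>zs\<close>; this
  yields new starts of longest paths.\<close>

lemma longest_replace_prefix:
  assumes "longest S (xs @ zs)" "distinct ys" "set ys = set xs" "successively adj ys"
    "last ys = last xs" "xs \<noteq> []"
  shows "longest S (ys @ zs)"
proof (rule longest_cong[OF assms(1)])
  have xs: "path S (xs @ zs)" using assms(1) by (simp add: longest_def)
  have ne: "ys \<noteq> []" using assms(3,6) by auto
  show "path S (ys @ zs)"
    using xs assms ne by (auto simp: path_def successively_append_iff)
  show "length (ys @ zs) = length (xs @ zs)"
    using xs assms(2,3) by (metis distinct_append distinct_card length_append path_def)
qed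

text \<open>Posa rotation: the edge from the old start \<open>hd xs\<close> to \<open>hd ys\<close>
  makes \<open>last xs\<close> the new start.\<close>

lemma longest_rotate:
  assumes "longest S (xs @ ys)" "xs \<noteq> []" "ys \<noteq> []" "adj (hd xs) (hd ys)"
  shows "longest S (rev xs @ ys)"
proof (rule longest_cong[OF assms(1)])
  have "path S (xs @ ys)" using assms(1) by (simp add: longest_def)
  moreover have "successively adj (rev xs)" if "successively adj xs"
    using that adj_sym by (auto simp: successively_rev intro: successively_mono)
  ultimately show "path S (rev xs @ ys)"
    using assms(2-4) by (auto simp: path_def successively_append_iff last_rev)
qed simp

lemma longest_nbrs:
  assumes "longest S xs"
  shows "nbrs S (hd xs) \<subseteq> set xs"
proof
  fix u assume u: "u \<in> nbrs S (hd xs)"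
  show "u \<in> set xs"
  proof (rule ccontr)
    assume "u \<notin> set xs"
    then have "path S (u # xs)"
      using assms u adj_sym by (auto simp: path_def longest_def nbrs_def successively_Cons)
    then show False using assms by (force simp: longest_def)
  qed
qed

text \<open>A neighbour at index \<open>j \<ge> 2\<close> closes a cycle on \<open>j + 1\<close>
  vertices, so \<open>j < l\<close>; indices 0 and 1 are covered by
  \<open>2 \<le> l\<close>.\<close>

lemma longest_nbrs_take:
  assumes xs: "longest S xs" and l: "2 \<le> l"
    and cyc: "\<And>xs. path S xs \<Longrightarrow> 3 \<le> length xs \<Longrightarrow> adj (hd xs) (last xs) \<Longrightarrow> length xs \<le> l"
  shows "nbrs S (hd xs) \<subseteq> set (take l xs)"
proof
  fix u assume u: "u \<in> nbrs S (hd xs)"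
  with longest_nbrs[OF xs] obtain j where j: "j < length xs" "xs ! j = u"
    by (metis in_set_conv_nth subsetD)
  have "j < l"
  proof (cases "2 \<le> j")
    case True
    have "path S (take (Suc j) xs)"
      using xs set_take_subset[of "Suc j" xs] successively_append_iff[of adj "take (Suc j) xs" "drop (Suc j) xs"]
      by (auto simp: path_def longest_def)
    moreover have "adj (hd (take (Suc j) xs)) (last (take (Suc j) xs))"
      using u j by (auto simp: nbrs_def take_Suc_conv_app_nth hd_append hd_conv_nth)
    ultimately show ?thesis using cyc[of "take (Suc j) xs"] True j by auto
  qed (use l in auto)
  then show "u \<in> set (take l xs)"
    using j by (auto simp: in_set_conv_nth)
qed

section \<open>Cliques from the degree bound\<close>

lemma clique_of_local_starts:
  assumes xs: "longest S xs"
    and deg: "\<And>v. v \<in> S \<Longrightarrow> k \<le> card (nbrs S v)"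
    and loc: "\<And>xs. longest S xs \<Longrightarrow> nbrs S (hd xs) \<subseteq> set (take (Suc k) xs)"
  shows "\<exists>K\<subseteq>S. card K = Suc k \<and> clique K"
proof -
  \<comment> \<open>The first \<open>k + 1\<close> vertices contain at most \<open>k\<close> besides
    the start, just enough for its degree, so it is adjacent to all of them.\<close>
  have full: "Suc k \<le> length ys \<and> nbrs S (hd ys) = set (take (Suc k) ys) - {hd ys}"
    if ys: "longest S ys" for ys
  proof -
    have p: "distinct ys" "set ys \<subseteq> S" "ys \<noteq> []"
      using ys by (auto simp: longest_def path_def)
    let ?T = "set (take (Suc k) ys)"
    have hd: "hd ys \<in> ?T" "hd ys \<in> S" using p by (cases ys; auto)+
    have sub: "nbrs S (hd ys) \<subseteq> ?T - {hd ys}"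
      using loc[OF ys] nbrs_subset by blast
    have cT: "card ?T = min (Suc k) (length ys)"
      using p by (simp add: distinct_card min.commute)
    have "k \<le> card (nbrs S (hd ys))" using deg hd by simp
    also have "\<dots> \<le> card (?T - {hd ys})" by (rule card_mono[OF _ sub]) simp
    also have "\<dots> = min (Suc k) (length ys) - 1" using cT hd by simp
    finally have k: "k \<le> min (Suc k) (length ys) - 1" .
    then have len: "Suc k \<le> length ys" using p(3) by (cases ys) auto
    have "nbrs S (hd ys) = ?T - {hd ys}"
      by (rule card_seteq[OF _ sub]) (use cT hd len deg in auto)
    with len show ?thesis by simp
  qed
  let ?T = "set (take (Suc k) xs)"
  have p: "distinct xs" "set xs \<subseteq> S" "xs \<noteq> []"
    using xs by (auto simp: longest_def path_def)
  have len: "Suc k \<le> length xs" and nb: "nbrs S (hd xs) = ?T - {hd xs}"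
    using full[OF xs] by auto
  \<comment> \<open>Rotating at index \<open>j\<close> makes \<open>xs ! j\<close> the start and
    only permutes the first \<open>k + 1\<close> vertices, so \<open>full\<close> applies with the
    same \<open>?T\<close>. The edge used ends in \<open>xs ! Suc j\<close>, which lies in
    \<open>?T\<close> because \<open>j < k\<close>.\<close>
  have nbj: "nbrs S (xs ! j) = ?T - {xs ! j}" if j: "j < k" for j
  proof -
    let ?A = "take (Suc j) xs" and ?B = "drop (Suc j) xs"
    have hdA: "hd ?A = hd xs" using p by (cases xs) auto
    have hdB: "hd ?B = xs ! Suc j" using j len by (simp add: hd_drop_conv_nth)
    have "xs ! Suc j \<in> ?T" using j len by (auto simp: in_set_conv_nth)
    moreover have "xs ! Suc j \<noteq> hd xs"
      using p j len by (simp add: hd_conv_nth nth_eq_iff_index_eq)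
    ultimately have "adj (hd ?A) (hd ?B)" using nb hdA hdB by (auto simp: nbrs_def)
    then have rot: "longest S (rev ?A @ ?B)"
      using longest_rotate[of S ?A ?B] xs j len p by auto
    have "hd (rev ?A @ ?B) = xs ! j"
      using j len p by (simp add: hd_append hd_rev take_Suc_conv_app_nth)
    moreover have "set (take (Suc k) (rev ?A @ ?B)) = ?T"
    proof -
      have "take (Suc k) (rev ?A @ ?B) = rev ?A @ take (k - j) ?B"
        using j len by simp
      moreover have "take (Suc k) xs = ?A @ take (k - j) ?B"
        using j by (metis Suc_diff_Suc add_Suc_right add_diff_inverse_nat diff_Suc_Suc not_less_iff_gr_or_eq plus_nat.simps(2) take_add)
      ultimately show ?thesis by auto
    qed
    ultimately show ?thesis using full[OF rot] by simp
  qed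
  have "adj u v" if uv: "u \<in> ?T" "v \<in> ?T" "u \<noteq> v" for u v
  proof -
    obtain a b where ab: "a < Suc k" "b < Suc k" "u = xs ! a" "v = xs ! b"
      using uv len by (auto simp: in_set_conv_nth)
    then have "a \<noteq> b" using uv(3) by auto
    \<comment> \<open>The vertex of index \<open>k\<close> is not covered by \<open>nbj\<close>; its
      adjacencies come from the other endpoint by symmetry.\<close>
    then have "a < k \<or> b < k" using ab by arith
    then consider "a < k" | "b < k" by blast
    then show ?thesis
    proof cases
      case 1
      then have "v \<in> nbrs S u" unfolding ab(3) nbj[OF 1] using uv(2,3) ab(3) by simp
      then show ?thesis by (simp add: nbrs_def)
    next
      case 2
      then have "u \<in> nbrs S v" unfolding ab(4) nbj[OF 2] using uv(1,3) ab(4) by simp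
      then show ?thesis using adj_sym by (simp add: nbrs_def)
    qed
  qed
  moreover have "?T \<subseteq> S" using p set_take_subset[of "Suc k" xs] by auto
  moreover have "card ?T = Suc k" using p len by (simp add: distinct_card)
  ultimately show ?thesis unfolding clique_def by blast
qed

text \<open>Pigeonhole in \<open>C - {u, v, w}\<close>. Applied to neighbourhoods \<open>N\<close>,
  it makes the non-edges inside \<open>C\<close> a matching.\<close>

lemma two_nonneighbours:
  assumes "finite C" "card C = k + 2" "N \<subseteq> C - {u}" "k \<le> card N" "u \<in> C"
    "v \<in> C - {u}" "w \<in> C - {u}" "v \<notin> N" "w \<notin> N"
  shows "v = w"
proof (rule ccontr)
  assume "v \<noteq> w"
  have "card N \<le> card (C - {u,v,w})"
    by (rule card_mono) (use assms in auto)
  also have "\<dots> = card C - 3"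
    using assms \<open>v \<noteq> w\<close> by (subst card_Diff_subset) auto
  finally have "k \<le> card C - 3" using assms(4) by simp
  \<comment> \<open>For \<open>k = 0\<close> the truncated \<open>card C - 3\<close> gives no
    contradiction, but three distinct elements in a set of size 2 do.\<close>
  moreover have "card {u, v, w} \<le> card C"
    by (rule card_mono) (use assms in auto)
  ultimately show False using assms(2,6,7) \<open>v \<noteq> w\<close> by auto
qed

lemma clique_or_colourable:
  assumes fin: "finite S" and card: "card S = k + 2"
    and deg: "\<And>v. v \<in> S \<Longrightarrow> k \<le> card (nbrs S v)"
    and ncol: "\<not> colourable S k"
  shows "\<exists>K\<subseteq>S. card K = Suc k \<and> clique K"
proof -
  have uniq: "v = w" if "u \<in> S" "v \<in> S" "w \<in> S" "v \<noteq> u" "w \<noteq> u" "\<not> adj u v" "\<not> adj u w" for u v w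
    using two_nonneighbours[OF fin card nbrs_subset deg[of u], of v w] that
    by (auto simp: nbrs_def)
  \<comment> \<open>Two disjoint non-edges would serve as colour classes, and the other
    \<open>k - 2\<close> vertices would get colours of their own.\<close>
  have meet: "w \<in> {u, v} \<or> z \<in> {u, v}"
    if S: "u \<in> S" "v \<in> S" "w \<in> S" "z \<in> S" and ne: "u \<noteq> v" "w \<noteq> z"
      and na: "\<not> adj u v" "\<not> adj w z" for u v w z
  proof (rule ccontr)
    assume "\<not> ?thesis"
    then have d: "w \<noteq> u" "w \<noteq> v" "z \<noteq> u" "z \<noteq> v" by auto
    have "card (S - {v, z}) = k"
      using card S d fin by (subst card_Diff_subset) auto
    then obtain e where e: "bij_betw e (S - {v, z}) {0..<k}"
      using ex_bij_betw_finite_nat[of "S - {v,z}"] fin by auto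
    \<comment> \<open>\<open>r\<close> merges \<open>v\<close> into \<open>u\<close> and
      \<open>z\<close> into \<open>w\<close>; \<open>e\<close> is injective on the \<open>k\<close>
      vertices that remain.\<close>
    define r where "r x = (if x = v then u else if x = z then w else x)" for x
    have r: "r x \<in> S - {v, z}" if "x \<in> S" for x
      using that S ne d by (auto simp: r_def)
    have "colourable S k"
      unfolding colourable_def
    proof (intro exI[of _ "e \<circ> r"] conjI ballI impI)
      fix x assume "x \<in> S"
      then have "e (r x) \<in> {0..<k}" using bij_betw_apply[OF e r] by simp
      then show "(e \<circ> r) x < k" by simp
    next
      fix x y assume xy: "x \<in> S" "y \<in> S" "adj x y"
      have "r x \<noteq> r y"
        using xy(3) na d adj_sym adj_irrefl by (auto simp: r_def split: if_splits)
      then show "(e \<circ> r) x \<noteq> (e \<circ> r) y"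
        using inj_onD[OF bij_betw_imp_inj_on[OF e] _ r r] xy by auto
    qed
    with ncol show False by simp
  qed
  show ?thesis
  proof (cases "\<exists>u\<in>S. \<exists>v\<in>S. u \<noteq> v \<and> \<not> adj u v")
    case False
    have "S \<noteq> {}" using card by auto
    then obtain u where u: "u \<in> S" by auto
    then have "S - {u} \<subseteq> S" "card (S - {u}) = Suc k" "clique (S - {u})"
      using False card by (auto simp: clique_def)
    then show ?thesis by blast
  next
    case True
    then obtain u v where uv: "u \<in> S" "v \<in> S" "u \<noteq> v" "\<not> adj u v" by auto
    \<comment> \<open>A second non-edge avoiding \<open>u\<close> would contain \<open>v\<close> by
      \<open>meet\<close>, giving \<open>v\<close> two non-neighbours against
      \<open>uniq\<close>.\<close>
    have "adj w z" if wz: "w \<in> S - {u}" "z \<in> S - {u}" "w \<noteq> z" for w z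
    proof (rule ccontr)
      assume na: "\<not> adj w z"
      then consider "w = v" | "z = v" using meet[of u v w z] uv wz by auto
      then show False
        using uniq[of v u z] uniq[of v u w] uv wz na adj_sym by cases blast+
    qed
    then have "S - {u} \<subseteq> S" "card (S - {u}) = Suc k" "clique (S - {u})"
      using card uv by (auto simp: clique_def)
    then show ?thesis by blast
  qed
qed

section \<open>Closed prefixes and the minimal non-colourable set\<close>

text \<open>A Hamiltonian path of \<open>set cs\<close> ending in \<open>last cs\<close> may replace
  \<open>cs\<close> in the longest path, and \<open>loc\<close> then confines the neighbours of its
  first vertex. So it suffices to find such a path from \<open>u\<close>.\<close>

lemma prefix_closed:
  assumes xs: "longest S (cs @ ds)"
    and len: "length cs = k + 2" and k: "3 \<le> k"
    and adj: "adj (hd cs) (last cs)"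
    and deg: "\<And>v. v \<in> S \<Longrightarrow> k \<le> card (nbrs S v)"
    and loc: "\<And>xs. longest S xs \<Longrightarrow> nbrs S (hd xs) \<subseteq> set (take (k + 2) xs)"
    and u: "u \<in> set cs" "u \<noteq> last cs"
  shows "nbrs S u \<subseteq> set cs"
proof -
  have p: "distinct cs" "set cs \<subseteq> S" "successively adj cs" "cs \<noteq> []"
    using xs len by (auto simp: longest_def path_def successively_append_iff)
  have start: "nbrs S (hd zs) \<subseteq> set cs"
    if zs: "distinct zs" "set zs = set cs" "successively adj zs" "last zs = last cs" for zs
  proof -
    have l: "longest S (zs @ ds)"
      by (rule longest_replace_prefix[OF xs zs p(4)])
    have "length zs = k + 2" "zs \<noteq> []"
      using zs p len by (metis distinct_card, auto)
    then show ?thesis using loc[OF l] zs(2) by simp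
  qed
  have miss: "adj v w \<or> adj v z"
    if "nbrs S v \<subseteq> set cs" "v \<in> set cs" "w \<in> set cs" "z \<in> set cs" "w \<noteq> v" "z \<noteq> v" "w \<noteq> z" for v w z
    using two_nonneighbours[of "set cs" k "nbrs S v" v w z] that nbrs_subset[of S v] deg[of v] p len
    by (auto simp: distinct_card nbrs_def)
  have rotate: "nbrs S (last ps) \<subseteq> set cs"
    if "cs = ps @ qs" "ps \<noteq> []" "qs \<noteq> []" "adj (hd ps) (hd qs)" for ps qs
  proof -
    have "successively adj (rev ps)"
      using p(3) that(1) adj_sym
      by (auto simp: successively_rev successively_append_iff intro: successively_mono)
    then show ?thesis
      using start[of "rev ps @ qs"] that p
      by (auto simp: successively_append_iff hd_append hd_rev last_rev)
  qed
  have hd: "nbrs S (hd cs) \<subseteq> set cs" using start[of cs] p by auto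
  obtain ps r where cs: "cs = ps @ u # r"
    using u(1) by (meson split_list)
  have "r \<noteq> []" using cs u(2) by auto
  then obtain b qs where r: "r = b # qs" by (cases r) auto
  \<comment> \<open>If rotating at \<open>u\<close> is impossible, then the non-edge between \<open>hd cs\<close> and \<open>b\<close> is the only one
    at either of them, and this forces a Hamiltonian path of \<open>set cs\<close> from \<open>u\<close> to \<open>last cs\<close>.\<close>
  show ?thesis
  proof (cases "adj (hd cs) b")
    case True
    moreover have "hd (ps @ [u]) = hd cs" using cs by (cases ps) auto
    ultimately show ?thesis using rotate[of "ps @ [u]" "b # qs"] cs r by simp
  next
    case False
    have ps: "ps \<noteq> []"
      using False p(3) cs r by (auto simp: successively_append_iff)
    \<comment> \<open>If \<open>b\<close> were the last vertex of \<open>cs\<close>, it would be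
      adjacent to \<open>hd cs\<close>.\<close>
    have "qs \<noteq> []" using False adj cs r by auto
    then obtain c qs' where qs: "qs = c # qs'" by (cases qs) auto
    obtain x ps' where x: "ps = x # ps'" using ps by (cases ps) auto
    have csx: "cs = x # ps' @ u # b # c # qs'" using cs r qs x by simp
    have xb: "\<not> adj x b" "\<not> adj b x" using False csx adj_sym by auto
    have xc: "adj x c" using miss[OF hd, of b c] xb csx p(1) by auto
    have b: "nbrs S b \<subseteq> set cs"
      using rotate[of "x # ps' @ [u, b]" "c # qs'"] csx xc by auto
    have badj: "adj b w" if "w \<in> set cs" "w \<noteq> x" "w \<noteq> b" for w
      using miss[OF b, of x w] that xb csx p(1) by auto
    show ?thesis
    proof (cases "ps' = []")
      case True
      \<comment> \<open>Here \<open>cs\<close> begins with \<open>x, u, b, c\<close>, and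
        \<open>3 \<le> k\<close> supplies a fifth vertex \<open>d\<close>. The new path begins with
        \<open>u, x, c, b, d\<close>.\<close>
      then obtain d qs'' where d: "qs' = d # qs''"
        using len k csx by (cases qs') auto
      have "adj b d" using badj[of d] csx d p(1) by auto
      moreover have "adj u x" "adj c b"
        using p(3) csx True adj_sym by auto
      ultimately show ?thesis
        using start[of "[u, x, c, b, d] @ qs''"] csx d True xc p
        by (auto simp: successively_append_iff insert_commute)
    next
      case False
      \<comment> \<open>The path runs through \<open>u\<close> and \<open>b\<close>, then
        \<open>ps\<close> backwards to \<open>x\<close>, then \<open>c\<close> and the rest of
        \<open>cs\<close>.\<close>
      have l: "last ps' \<in> set ps'" using False by simp
      then have "last ps' \<noteq> x" "last ps' \<noteq> b" using csx p(1) by auto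
      then have "adj b (last ps)"
        using badj[of "last ps'"] csx x l False by simp
      moreover have "successively adj (rev ps)"
        using p(3) cs adj_sym
        by (auto simp: successively_rev successively_append_iff intro: successively_mono)
      moreover have "adj u b" using p(3) cs r by (auto simp: successively_append_iff)
      moreover have "successively adj qs" using p(3) cs r by (auto simp: successively_append_iff successively_Cons)
      ultimately have "successively adj (u # b # rev ps @ qs)"
        using x qs xc by (auto simp: successively_append_iff successively_Cons hd_append hd_rev last_rev)
      moreover have "last (u # b # rev ps @ qs) = last cs" using cs r qs by simp
      moreover have "set (u # b # rev ps @ qs) = set cs" using cs r by auto
      moreover have "distinct (u # b # rev ps @ qs)" using p(1) cs r by auto
      ultimately show ?thesis using start[of "u # b # rev ps @ qs"] by (metis list.sel(1))
    qed
  qed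
qed

text \<open>\<open>cyc\<close> passes to subsets, which permits induction on \<open>S\<close>. For
  \<open>i = 2\<close>, \<open>5 \<le> k + i\<close> supplies the \<open>3 \<le> k\<close> that
  \<open>prefix_closed\<close> demands.\<close>

lemma colourable_or_clique:
  assumes "finite S" and i: "i \<le> 2" and l: "5 \<le> k + i"
    and cyc: "\<And>xs. path S xs \<Longrightarrow> 3 \<le> length xs \<Longrightarrow> adj (hd xs) (last xs) \<Longrightarrow> length xs \<le> k + i"
  shows "colourable S k \<or> (\<exists>K\<subseteq>S. card K = Suc k \<and> clique K)"
  using assms(1) cyc
proof (induction S rule: finite_psubset_induct)
  case (psubset S)
  note cyc = psubset.prems
  show ?case
  proof (subst disj_imp, rule impI)
    assume ncol: "\<not> colourable S k"
    show "\<exists>K\<subseteq>S. card K = Suc k \<and> clique K"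
    proof (rule ccontr)
      assume ncl: "\<not> ?thesis"
      \<comment> \<open>A clique of size \<open>k + 1\<close> in \<open>T\<close> would be one in
        \<open>S\<close>, so the induction hypothesis leaves only colourability.\<close>
      have sub: "colourable T k" if T: "T \<subset> S" for T
      proof -
        have "path S xs" if "path T xs" for xs
          using that T by (auto simp: path_def)
        then show ?thesis using psubset.IH[OF T] cyc ncl T by (meson order_trans psubset_imp_subset)
      qed
      have deg: "k \<le> card (nbrs S v)" if "v \<in> S" for v
      proof -
        have "colourable (S - {v}) k" using that by (intro sub) auto
        then show ?thesis
          using colourable_extend[of S v k] ncol psubset.hyps by (auto simp: not_less[symmetric])
      qed
      have loc: "nbrs S (hd xs) \<subseteq> set (take (k + i) xs)" if "longest S xs" for xs
        by (rule longest_nbrs_take[OF that]) (use l cyc in auto)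
      have "S \<noteq> {}" using ncol by (auto simp: colourable_def)
      then obtain xs0 where "longest S xs0" using longest_exists psubset.hyps by blast
      then obtain xs where xs: "longest S xs" "\<not> nbrs S (hd xs) \<subseteq> set (take (Suc k) xs)"
        using clique_of_local_starts[OF _ deg] ncl by blast
      have "i = 2"
      proof (rule ccontr)
        assume "i \<noteq> 2"
        then have "set (take (k + i) xs) \<subseteq> set (take (Suc k) xs)"
          using i by (intro set_take_subset_set_take) auto
        then show False using loc[OF xs(1)] xs(2) by blast
      qed
      note loc = loc[unfolded this] and l = l[unfolded this]
      let ?cs = "take (k + 2) xs"
      obtain u where u: "u \<in> nbrs S (hd xs)" "u \<notin> set (take (Suc k) xs)"
        using xs(2) by auto
      have "u \<in> set ?cs" using loc xs(1) u by auto
      \<comment> \<open>Among the first \<open>k + 2\<close> positions only index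
        \<open>Suc k\<close> lies beyond the first \<open>k + 1\<close>; hence \<open>u\<close> ends
        \<open>?cs\<close> and closes it to a cycle.\<close>
      then have len: "k + 2 \<le> length xs" and u_eq: "u = xs ! Suc k"
        using u(2) by (auto simp: in_set_conv_nth less_Suc_eq)
      have lc: "length ?cs = k + 2" using len by simp
      have cs: "?cs = take (Suc k) xs @ [u]"
        using len u_eq by (simp add: take_Suc_conv_app_nth)
      have path: "distinct xs" "set xs \<subseteq> S" "xs \<noteq> []"
        using xs(1) by (auto simp: longest_def path_def)
      have last: "last ?cs = u" using cs by simp
      have sC: "set ?cs \<subseteq> S" using path set_take_subset[of "k + 2" xs] by auto
      have cC: "card (set ?cs) = k + 2" using path len by (simp add: distinct_card)
      have closed: "nbrs S v \<subseteq> set ?cs" if "v \<in> set ?cs" "v \<noteq> u" for v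
      proof (rule prefix_closed[where ds = "drop (k + 2) xs", OF _ lc _ _ deg loc that(1)])
        show "adj (hd ?cs) (last ?cs)" using u last by (simp add: nbrs_def)
      qed (use xs l that last in auto)
      show False
      proof (cases "set ?cs = S")
        case True
        then show False
          using clique_or_colourable[OF psubset.hyps _ deg ncol] cC ncl by auto
      next
        case False
        \<comment> \<open>Removing \<open>hd xs\<close> already makes the second side of the gluing
          a proper subset of \<open>S\<close>.\<close>
        have "hd xs \<in> set ?cs" "hd xs \<noteq> u" "hd xs \<in> S"
          using path u adj_irrefl by (cases xs; auto simp: nbrs_def)+
        then have "colourable (S - (set ?cs - {u})) k" by (intro sub) auto
        moreover have "colourable (set ?cs) k" using False sC by (intro sub) auto
        ultimately have "colourable S k"
          using colourable_glue[OF _ _ sC _ closed] \<open>u \<in> set ?cs\<close> by blast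
        then show False using ncol by simp
      qed
    qed
  qed
qed

end

section \<open>Cycles as arc lists, and transfer to the theorem\<close>

text \<open>The \<open>zip\<close> lists the arcs of the walk visiting \<open>x # xs @ [v]\<close>
  in order; with \<open>v = x\<close> it closes \<open>x # xs\<close> to a cycle with equally many
  arcs.\<close>

lemma pcas_zip:
  "pcas x (zip (x # xs) (xs @ [v])) v"
  by (induction xs arbitrary: x) auto

lemma pawalk_verts_zip:
  "pawalk_verts x (zip (x # xs) (xs @ [v])) = x # xs @ [v]"
  by (induction xs arbitrary: x) auto

lemma zip_arcs:
  assumes "successively (\<lambda>u v. (u, v) \<in> A) (x # xs)" "(last (x # xs), v) \<in> A"
  shows "set (zip (x # xs) (xs @ [v])) \<subseteq> A"
  using assms by (induction xs arbitrary: x) auto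

lemma length_in_cycle_lengths:
  assumes "distinct xs" "set xs \<subseteq> pverts G" "successively (\<lambda>u v. (u, v) \<in> parcs G) xs"
    "(last xs, hd xs) \<in> parcs G" "3 \<le> length xs"
  shows "length xs \<in> cycle_lengths G"
proof -
  obtain x ys where xs: "xs = x # ys" using assms(5) by (cases xs) auto
  let ?p = "zip (x # ys) (ys @ [x])"
  have "pre_digraph.awalk (with_proj G) x ?p x"
    unfolding pre_digraph.awalk_def cas_with_proj_eq
    using zip_arcs[of "parcs G" x ys x] pcas_zip[of x ys x] assms xs by auto
  moreover have "distinct (tl (pre_digraph.awalk_verts (with_proj G) x ?p))"
    unfolding awalk_verts_with_proj_eq pawalk_verts_zip using assms xs by auto
  moreover have "?p \<noteq> []" by (cases ys) auto
  ultimately have "pre_digraph.cycle (with_proj G) ?p"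
    unfolding pre_digraph.cycle_def by blast
  moreover have "length ?p = length xs" using xs by simp
  ultimately show ?thesis 
    using assms(5) unfolding cycle_lengths_def mem_Collect_eq by metis
qed

theorem theorem12:
  fixes G :: "'a pair_pre_digraph" and i :: nat
  assumes "pair_graph G"
    and "Digraph_Component.connected (with_proj G)"
    and "card (cycle_lengths G) \<ge> 4"
    and "i \<in> {0, 1, 2}"
    and "\<not> (i = 2 \<and> card (odd_cycle_lengths G) = 3 \<and> card (even_cycle_lengths G) = 2)"
    and "clique_number G \<le> circumference G - i"
  shows "chromatic_number G \<le> circumference G - i"
proof -
  interpret G: pair_graph G by fact
  interpret simple_graph "\<lambda>u v. (u, v) \<in> parcs G"
  proof
    show "(v, u) \<in> parcs G" if "(u, v) \<in> parcs G" for u v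
      using that G.pair_sym_arcs by (auto simp: symmetric_def sym_def)
    show "(u, u) \<notin> parcs G" for u
      using G.pair_no_loops[of "(u, u)"] by auto
  qed
  let ?l = "circumference G" and ?k = "circumference G - i"
  \<comment> \<open>An infinite set would have \<open>card\<close> 0; finiteness makes
    \<open>Max\<close> an upper bound.\<close>
  have fin: "finite (cycle_lengths G)"
    using assms(3) card.infinite by fastforce
  have max: "m \<le> ?l" if "m \<in> cycle_lengths G" for m
    using that fin by (simp add: circumference_def)
  have "cycle_lengths G \<subseteq> {3..?l}"
  proof
    fix m assume m: "m \<in> cycle_lengths G"
    then have "3 \<le> m" by (auto simp: cycle_lengths_def)
    then show "m \<in> {3..?l}" using max[OF m] by simp
  qed
  then have "card (cycle_lengths G) \<le> ?l - 2"
    using card_mono[of "{3..?l}"] by fastforce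
  \<comment> \<open>Four lengths must fit into the \<open>?l - 2\<close> numbers from 3 to
    \<open>?l\<close>.\<close>
  then have l: "6 \<le> ?l" using assms(3) by simp
  have cyc: "length xs \<le> ?k + i"
    if "path (pverts G) xs" "3 \<le> length xs" "(hd xs, last xs) \<in> parcs G" for xs
    using max[OF length_in_cycle_lengths[of xs G]] that adj_sym by (auto simp: path_def)
  have "colourable (pverts G) ?k \<or> (\<exists>K\<subseteq>pverts G. card K = Suc ?k \<and> clique K)"
  proof (rule colourable_or_clique[OF G.pair_finite_verts])
    show "i \<le> 2" "5 \<le> ?k + i" using assms(4) l by auto
  qed (rule cyc)
  moreover have "card K \<le> ?k" if K: "K \<subseteq> pverts G" "clique K" for K
  proof -
    have "finite {card K |K. is_clique G K}"
      by (rule finite_subset[of _ "card ` Pow (pverts G)"])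
        (auto simp: is_clique_def G.pair_finite_verts)
    moreover have "is_clique G K" using K by (simp add: is_clique_def clique_def)
    ultimately have "card K \<le> clique_number G"
      unfolding clique_number_def by (intro Max_ge) auto
    then show ?thesis using assms(6) by simp
  qed
  ultimately have "colourable (pverts G) ?k" by (metis Suc_n_not_le_n)
  then obtain c where c: "\<forall>v\<in>pverts G. c v < ?k"
      "\<forall>u\<in>pverts G. \<forall>v\<in>pverts G. (u, v) \<in> parcs G \<longrightarrow> c u \<noteq> c v"
    unfolding colourable_def by blast
  have "c u \<noteq> c v" if "(u, v) \<in> parcs G" for u v
    using c(2) that G.in_arcsD1[OF that] G.in_arcsD2[OF that] by blast
  then have "proper_colouring G ?k c"
    unfolding proper_colouring_def using c(1) by blast
  then show ?thesis
    unfolding chromatic_number_def by (intro Least_le) blast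
qed

end
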